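(* Let $G$ be a finite group, $p>2$ a prime, and $n>0$ an integer with $\gcd(n,p)=1$. Then $P_e(G)\cong P_e(\mathbb{Z}_p\times\mathbb{Z}_p\times\mathbb{Z}_p\times\mathbb{Z}_n)$ if and only if $G\cong \mathbb{Z}_p\times\mathbb{Z}_p\times\mathbb{Z}_p\times\mathbb{Z}_n$ or $G\cong K\times\mathbb{Z}_n$, where $K$ is the unique non-abelian group of order $p^3$ and exponent $p$.
   Context: All groups are finite. $\mathbb{Z}_k$ denotes the cyclic group of order $k$. $K$ is the non-abelian group of order $p^3$ and exponent $p$, with presentation $\langle x,y,z \mid x^p=y^p=z^p=1,\ [x,y]=z,\ [x,z]=[y,z]=1\rangle$. For a group $X$, the enhanced power graph $P_e(X)$ is the simple graph with vertex set $X$ in which two distinct vertices $x,y$ are adjacent if and only if $\langle x,y\rangle$ is cyclic. *)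

theory Defs
  imports "HOL-Algebra.Algebra"
begin

definition epg_adj :: "('a, 'b) monoid_scheme \<Rightarrow> 'a \<Rightarrow> 'a \<Rightarrow> bool" where
  "epg_adj G x y \<longleftrightarrow> x \<in> carrier G \<and> y \<in> carrier G \<and> x \<noteq> y \<and>
     (\<exists>g \<in> carrier G. generate G {x, y} = generate G {g})"

definition epg_iso :: "('a, 'b) monoid_scheme \<Rightarrow> ('c, 'd) monoid_scheme \<Rightarrow> bool" where
  "epg_iso G H \<longleftrightarrow> (\<exists>f. bij_betw f (carrier G) (carrier H) \<and>
     (\<forall>x \<in> carrier G. \<forall>y \<in> carrier G. epg_adj G x y \<longleftrightarrow> epg_adj H (f x) (f y)))"

text \<open>The non-abelian group of order p^3 and exponent p (p odd), realised as the Heisenberg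
  group over Z_p: (a,b,c)(a',b',c') = (a+a', b+b', c+c'+a b'). With x=(1,0,0), y=(0,1,0),
  z=[x,y] this satisfies the given presentation.\<close>
definition heis_group :: "nat \<Rightarrow> (int \<times> int \<times> int) monoid" where
  "heis_group p = \<lparr> carrier = {0..<int p} \<times> {0..<int p} \<times> {0..<int p},
     monoid.mult = (\<lambda>(a, b, c) (a', b', c').
               ((a + a') mod int p, (b + b') mod int p, (c + c' + a * b') mod int p)),
     one = (0, 0, 0) \<rparr>"

end

theory Submission
  imports Defs "HOL-Number_Theory.Cong"
begin

text \<open>Away from its dominating vertices, the enhanced power graph of
  \<open>\<int>\<^sub>p \<times> \<int>\<^sub>p \<times> \<int>\<^sub>p \<times> \<int>\<^sub>n\<close> is a disjoint union of cliques. If \<open>G\<close> has the same graph, each such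
  clique together with the set \<open>D\<close> of the \<open>n\<close> dominating vertices is a cyclic subgroup of order \<open>pn\<close>.
  Hence \<open>D\<close> is a central cyclic subgroup of order \<open>n\<close>, every Sylow \<open>p\<close>-subgroup \<open>P\<close> has order \<open>p\<^sup>3\<close> and
  exponent \<open>p\<close>, and \<open>G = P \<times> D\<close>; the groups of order \<open>p\<^sup>3\<close> and exponent \<open>p\<close> are classified by hand.
  Conversely, the graph only depends on the power maps, and for odd \<open>p\<close> the Heisenberg group and
  the elementary abelian group are related by a bijection that commutes with all power maps.\<close>

section \<open>Cocyclic pairs and power-preserving bijections\<close>

text \<open>Membership in a common cyclic subgroup, phrased through powers alone so that maps
  respecting powers transport it. Unlike adjacency it holds for equal elements of the carrier; in a
  finite group natural exponents reach all of a cyclic subgroup.\<close>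

definition cocyclic :: "('a, 'b) monoid_scheme \<Rightarrow> 'a \<Rightarrow> 'a \<Rightarrow> bool" where
  "cocyclic G x y \<longleftrightarrow> (\<exists>z \<in> carrier G. \<exists>(i :: nat) (j :: nat). x = z [^]\<^bsub>G\<^esub> i \<and> y = z [^]\<^bsub>G\<^esub> j)"

text \<open>Weaker than an isomorphism: products of different elements need not be respected, so
  non-isomorphic groups can be related in this way.\<close>

definition pow_bij :: "('a \<Rightarrow> 'c) \<Rightarrow> ('a, 'b) monoid_scheme \<Rightarrow> ('c, 'd) monoid_scheme \<Rightarrow> bool" where
  "pow_bij f G H \<longleftrightarrow> bij_betw f (carrier G) (carrier H) \<and>
     (\<forall>x \<in> carrier G. \<forall>k :: nat. f (x [^]\<^bsub>G\<^esub> k) = f x [^]\<^bsub>H\<^esub> k)"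

lemma cocyclicI: "z \<in> carrier G \<Longrightarrow> cocyclic G (z [^]\<^bsub>G\<^esub> (i::nat)) (z [^]\<^bsub>G\<^esub> (j::nat))"
  by (auto simp: cocyclic_def)

lemma cocyclic_sym: "cocyclic G x y \<Longrightarrow> cocyclic G y x"
  by (auto simp: cocyclic_def)

lemma (in group) cocyclic_refl: "x \<in> carrier G \<Longrightarrow> cocyclic G x x"
  using cocyclicI[of x G 1 1] by simp

lemma (in group) cocyclic_closed: "cocyclic G x y \<Longrightarrow> x \<in> carrier G \<and> y \<in> carrier G"
  by (auto simp: cocyclic_def)

text \<open>Bezout writes \<open>gcd i j\<close> as an integer combination of \<open>i\<close> and
  \<open>j\<close>. This is what makes two powers of one element adjacent or equal.\<close>

lemma (in group) generate_pair_pow: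
  fixes i j :: nat
  assumes z: "z \<in> carrier G"
  shows "generate G {z [^] i, z [^] j} = generate G {z [^] gcd i j}"
proof
  have "subgroup (generate G {z [^] gcd i j}) G"
    using z by (intro generate_is_subgroup) auto
  moreover have "z [^] k \<in> generate G {z [^] gcd i j}" if dvd: "gcd i j dvd k" for k :: nat
  proof -
    obtain m where "k = gcd i j * m" using dvd by blast
    then have "z [^] k = (z [^] gcd i j) [^] int m"
      using z by (simp add: nat_pow_pow int_pow_int)
    then show ?thesis
      unfolding generate_pow[OF nat_pow_closed[OF z]] by blast
  qed
  ultimately show "generate G {z [^] i, z [^] j} \<subseteq> generate G {z [^] gcd i j}"
    by (intro generate_subgroup_incl) auto
next
  have sub: "subgroup (generate G {z [^] i, z [^] j}) G"
    using z by (intro generate_is_subgroup) auto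
  obtain u v where uv: "u * int i + v * int j = gcd (int i) (int j)"
    using bezout_int by blast
  have "z [^] gcd i j = z [^] (u * int i + v * int j)"
    unfolding uv by (simp add: gcd_int_int_eq int_pow_int)
  also have "\<dots> = (z [^] i) [^] u \<otimes> (z [^] j) [^] v"
    using z by (simp add: int_pow_mult int_pow_pow mult.commute flip: int_pow_int)
  also have "\<dots> \<in> generate G {z [^] i, z [^] j}"
    using sub by (intro subgroup.m_closed[OF sub] subgroup_int_pow_closed[OF sub]) (auto intro: generate.incl)
  finally show "generate G {z [^] gcd i j} \<subseteq> generate G {z [^] i, z [^] j}"
    using sub by (intro generate_subgroup_incl) auto
qed

text \<open>By finiteness, \<open>x\<close> and \<open>y\<close> are natural powers of any generator
  of \<open>generate G {x, y}\<close>; conversely, two powers of \<open>z\<close> generate the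
  cyclic subgroup of the gcd power.\<close>

lemma epg_adj_iff_cocyclic:
  assumes "group G" "finite (carrier G)"
  shows "epg_adj G x y \<longleftrightarrow> x \<noteq> y \<and> cocyclic G x y"
proof -
  interpret group G by fact
  have "\<exists>(i :: nat) (j :: nat). x = g [^]\<^bsub>G\<^esub> i \<and> y = g [^]\<^bsub>G\<^esub> j"
    if "g \<in> carrier G" "generate G {x, y} = generate G {g}" for g
  proof -
    have "x \<in> generate G {g}" "y \<in> generate G {g}"
      using that(2) by (auto intro: generate.incl simp flip: that(2))
    then show ?thesis
      unfolding generate_pow_on_finite_carrier[OF assms(2) that(1)] by auto
  qed
  then show ?thesis
    unfolding epg_adj_def cocyclic_def using generate_pair_pow nat_pow_closed by metis
qed

text \<open>A common root is pushed forward along \<open>f\<close>; for the converse a root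
  \<open>w\<close> is pulled back by surjectivity, and injectivity recovers \<open>x\<close> and
  \<open>y\<close> as powers of the preimage.\<close>

lemma pow_bij_cocyclic:
  assumes "group G" "group H" "pow_bij f G H" "x \<in> carrier G" "y \<in> carrier G"
  shows "cocyclic G x y \<longleftrightarrow> cocyclic H (f x) (f y)"
proof
  interpret G: group G by fact
  interpret H: group H by fact
  have bij: "bij_betw f (carrier G) (carrier H)"
    and pow: "\<And>x k. x \<in> carrier G \<Longrightarrow> f (x [^]\<^bsub>G\<^esub> (k::nat)) = f x [^]\<^bsub>H\<^esub> k"
    using assms(3) by (auto simp: pow_bij_def)
  show "cocyclic G x y \<Longrightarrow> cocyclic H (f x) (f y)"
    using pow bij unfolding cocyclic_def by (metis bij_betwE)
  assume "cocyclic H (f x) (f y)"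
  then obtain w i j where w: "w \<in> carrier H" "f x = w [^]\<^bsub>H\<^esub> (i::nat)" "f y = w [^]\<^bsub>H\<^esub> (j::nat)"
    by (auto simp: cocyclic_def)
  then obtain z where z: "z \<in> carrier G" "w = f z"
    using bij by (auto simp: bij_betw_def)
  then have "x = z [^]\<^bsub>G\<^esub> i" "y = z [^]\<^bsub>G\<^esub> j"
    using w pow assms(4,5) bij_betw_imp_inj_on[OF bij] by (metis G.nat_pow_closed inj_onD)+
  then show "cocyclic G x y"
    using z(1) by (auto simp: cocyclic_def)
qed

lemma pow_bij_imp_epg_iso:
  assumes "group G" "group H" "finite (carrier G)" "pow_bij f G H"
  shows "epg_iso G H"
proof -
  have bij: "bij_betw f (carrier G) (carrier H)"
    using assms(4) by (auto simp: pow_bij_def)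
  then have "finite (carrier H)"
    using assms(3) by (simp add: bij_betw_finite)
  then show ?thesis
    unfolding epg_iso_def
    using bij epg_adj_iff_cocyclic[OF assms(1,3)] epg_adj_iff_cocyclic[OF assms(2)]
      pow_bij_cocyclic[OF assms(1,2,4)] by (metis bij_betw_imp_inj_on inj_onD)
qed

lemma epg_iso_trans:
  assumes "epg_iso G H" "epg_iso H I"
  shows "epg_iso G I"
proof -
  obtain f g where f: "bij_betw f (carrier G) (carrier H)"
      "\<And>x y. x \<in> carrier G \<Longrightarrow> y \<in> carrier G \<Longrightarrow> epg_adj G x y \<longleftrightarrow> epg_adj H (f x) (f y)"
    and g: "bij_betw g (carrier H) (carrier I)"
      "\<And>x y. x \<in> carrier H \<Longrightarrow> y \<in> carrier H \<Longrightarrow> epg_adj H x y \<longleftrightarrow> epg_adj I (g x) (g y)"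
    using assms unfolding epg_iso_def by blast
  have "bij_betw (g \<circ> f) (carrier G) (carrier I)"
    using f(1) g(1) by (rule bij_betw_trans)
  moreover have "epg_adj G x y \<longleftrightarrow> epg_adj I ((g \<circ> f) x) ((g \<circ> f) y)"
    if "x \<in> carrier G" "y \<in> carrier G" for x y
    using f(2) g(2) that bij_betwE[OF f(1)] by simp
  ultimately show ?thesis unfolding epg_iso_def by blast
qed

lemma iso_imp_pow_bij:
  assumes "group G" "group H" "f \<in> iso G H"
  shows "pow_bij f G H"
proof -
  interpret group_hom G H f
    using assms by (auto simp: group_hom_def group_hom_axioms_def iso_def)
  show ?thesis
    using assms(3) hom_nat_pow by (auto simp: pow_bij_def iso_def)
qed

lemma pow_bij_trans:
  assumes "pow_bij f G H" "pow_bij g H I"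
  shows "pow_bij (g \<circ> f) G I"
  using assms by (auto simp: pow_bij_def bij_betwE intro: bij_betw_trans)

lemma nat_pow_DirProd:
  fixes k :: nat
  shows "(x, y) [^]\<^bsub>G \<times>\<times> H\<^esub> k = (x [^]\<^bsub>G\<^esub> k, y [^]\<^bsub>H\<^esub> k)"
  by (induction k) auto

lemma pow_bij_DirProd:
  assumes "pow_bij f G H" "pow_bij g G' H'"
  shows "pow_bij (map_prod f g) (G \<times>\<times> G') (H \<times>\<times> H')"
  using assms by (auto simp: pow_bij_def nat_pow_DirProd bij_betw_map_prod)

section \<open>The Heisenberg group and its power maps\<close>

lemma heis_group_carrier: "carrier (heis_group p) = {0..<int p} \<times> {0..<int p} \<times> {0..<int p}"
  by (simp add: heis_group_def)

lemma heis_group_one: "\<one>\<^bsub>heis_group p\<^esub> = (0, 0, 0)"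
  by (simp add: heis_group_def)

lemma heis_group_mult:
  "(a, b, c) \<otimes>\<^bsub>heis_group p\<^esub> (a', b', c') =
     ((a + a') mod int p, (b + b') mod int p, (c + c' + a * b') mod int p)"
  by (simp add: heis_group_def)

text \<open>Residues may be replaced by arbitrary integer representatives inside a product, which
  turns associativity and power formulas into integer polynomial identities.\<close>

lemma heis_group_mult_mod:
  "(a mod int p, b mod int p, c mod int p) \<otimes>\<^bsub>heis_group p\<^esub> (a', b', c') =
     ((a + a') mod int p, (b + b') mod int p, (c + c' + a * b') mod int p)"
  "(a', b', c') \<otimes>\<^bsub>heis_group p\<^esub> (a mod int p, b mod int p, c mod int p) =
     ((a' + a) mod int p, (b' + b) mod int p, (c' + c + a' * b) mod int p)"
  unfolding heis_group_mult by (auto intro!: mod_add_cong mod_mult_cong)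

lemma group_heis_group:
  assumes "p > 0"
  shows "group (heis_group p)"
proof (rule groupI)
  fix x assume "x \<in> carrier (heis_group p)"
  then obtain a b c where x: "x = (a, b, c)" "a \<in> {0..<int p}" "b \<in> {0..<int p}" "c \<in> {0..<int p}"
    by (auto simp: heis_group_carrier)
  show "\<one>\<^bsub>heis_group p\<^esub> \<otimes>\<^bsub>heis_group p\<^esub> x = x"
    using x by (simp add: heis_group_one heis_group_mult)
  \<comment> \<open>A left inverse with first coordinate \<open>- a\<close> needs a third coordinate
    \<open>c'\<close> with \<open>c' + c - a * b = 0\<close>.\<close>
  let ?y = "((- a) mod int p, (- b) mod int p, (a * b - c) mod int p)"
  have "?y \<otimes>\<^bsub>heis_group p\<^esub> x = \<one>\<^bsub>heis_group p\<^esub>"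
    using x(1) by (simp add: heis_group_mult heis_group_one mod_simps mod_add_cong algebra_simps)
  moreover have "?y \<in> carrier (heis_group p)"
    using assms by (simp add: heis_group_carrier)
  ultimately show "\<exists>y\<in>carrier (heis_group p). y \<otimes>\<^bsub>heis_group p\<^esub> x = \<one>\<^bsub>heis_group p\<^esub>"
    by blast
next
  fix x y z :: "int \<times> int \<times> int"
  obtain a b c a' b' c' a'' b'' c''
    where xyz: "x = (a, b, c)" "y = (a', b', c')" "z = (a'', b'', c'')"
    by (cases x, cases y, cases z)
  show "x \<otimes>\<^bsub>heis_group p\<^esub> y \<otimes>\<^bsub>heis_group p\<^esub> z = x \<otimes>\<^bsub>heis_group p\<^esub> (y \<otimes>\<^bsub>heis_group p\<^esub> z)"
    unfolding xyz heis_group_mult[of p a b c a' b' c'] heis_group_mult[of p a' b' c' a'' b'' c'']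
      heis_group_mult_mod by (simp add: algebra_simps)
qed (use assms in \<open>auto simp: heis_group_carrier heis_group_one heis_group_mult\<close>)

abbreviation (input) elem_abelian_cube :: "nat \<Rightarrow> (int \<times> int \<times> int) monoid" where
  "elem_abelian_cube p \<equiv> integer_mod_group p \<times>\<times> integer_mod_group p \<times>\<times> integer_mod_group p"

text \<open>Up to the factor 2, these are the exponential coordinates of the Heisenberg group, in which
  powers are taken coordinatewise.\<close>
lemma pow_bij_heis:
  assumes "odd p"
  shows "pow_bij (\<lambda>(a, b, c). (a, b, (2 * c - a * b) mod int p)) (heis_group p) (elem_abelian_cube p)"
    (is "pow_bij ?f ?H ?A")
proof -
  have p: "p > 0" using assms by (cases p) auto
  interpret H: group ?H by (rule group_heis_group[OF p])
  \<comment> \<open>Oddness enters here: 2 is invertible modulo \<open>p\<close>, so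
    \<open>c\<close> can be recovered from \<open>2 * c - a * b\<close>.\<close>
  have cop: "coprime (int p) 2" using assms by simp
  have carA: "carrier ?A = carrier ?H"
    using p by (simp add: heis_group_carrier carrier_integer_mod_group)
  have fin: "finite (carrier ?H)" by (simp add: heis_group_carrier)
  have inj: "inj_on ?f (carrier ?H)"
  proof (rule inj_onI, clarsimp simp: heis_group_carrier)
    fix a b c c' :: int
    assume c: "0 \<le> c" "c < int p" "0 \<le> c'" "c' < int p"
      and "(2 * c - a * b) mod int p = (2 * c' - a * b) mod int p"
    then have "int p dvd 2 * (c - c')"
      by (simp add: mod_eq_dvd_iff algebra_simps)
    then have "int p dvd c - c'"
      using coprime_dvd_mult_right_iff[OF cop] by blast
    then show "c = c'"
      using c by (metis mod_eq_dvd_iff mod_pos_pos_trivial)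
  qed
  have "?f ` carrier ?H \<subseteq> carrier ?A"
    using p by (auto simp: heis_group_carrier carrier_integer_mod_group)
  then have bij: "bij_betw ?f (carrier ?H) (carrier ?A)"
    using inj fin unfolding carA bij_betw_def by (simp add: card_image card_subset_eq)
  have pow: "?f (x [^]\<^bsub>?H\<^esub> k) = ?f x [^]\<^bsub>?A\<^esub> k" if "x \<in> carrier ?H" for x and k :: nat
  proof -
    obtain a b c where x: "x = (a, b, c)" by (cases x)
    \<comment> \<open>The expression \<open>2 * c - a * b\<close> is multiplied by \<open>k\<close>
      under the \<open>k\<close>-th power. An unreduced \<open>c'\<close> keeps this an identity
      over the integers, which suits the induction.\<close>
    have "\<exists>c'. x [^]\<^bsub>?H\<^esub> k = (int k * a mod int p, int k * b mod int p, c' mod int p) \<and>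
        2 * c' - (int k * a) * (int k * b) = int k * (2 * c - a * b)"
    proof (induction k)
      case 0
      then show ?case by (intro exI[of _ 0]) (simp add: heis_group_one)
    next
      case (Suc k)
      then obtain c' where c': "x [^]\<^bsub>?H\<^esub> k = (int k * a mod int p, int k * b mod int p, c' mod int p)"
        "2 * c' - (int k * a) * (int k * b) = int k * (2 * c - a * b)" by blast
      \<comment> \<open>The witness is the third coordinate of the product of the
        \<open>k\<close>-th power with \<open>x\<close>.\<close>
      show ?case
        using c' by (intro exI[of _ "c' + c + int k * a * b"])
          (simp add: x heis_group_mult_mod algebra_simps)
    qed
    then obtain c' where c': "x [^]\<^bsub>?H\<^esub> k = (int k * a mod int p, int k * b mod int p, c' mod int p)"
      "2 * c' - (int k * a) * (int k * b) = int k * (2 * c - a * b)" by blast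
    have "(2 * (c' mod int p) - int k * a mod int p * (int k * b mod int p)) mod int p
        = (2 * c' - int k * a * (int k * b)) mod int p"
      by (intro mod_diff_cong mod_mult_cong) simp_all
    then show ?thesis
      unfolding c'(1) c'(2) by (simp add: x nat_pow_DirProd mod_simps)
  qed
  show ?thesis
    using bij pow by (auto simp: pow_bij_def)
qed

section \<open>Groups of order \<open>p\<^sup>3\<close> and exponent \<open>p\<close>\<close>

lemma (in group) int_pow_nat_pow_eq_id:
  assumes "x \<in> carrier G" "x [^] (p :: nat) = \<one>" "int p dvd k"
  shows "x [^] (k :: int) = \<one>"
  using assms by (metis dvd_trans int_dvd_int_iff int_pow_eq_id pow_eq_id)

lemma (in group) int_pow_mod:
  assumes "x \<in> carrier G" "x [^] (p :: nat) = \<one>"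
  shows "x [^] (k mod int p) = x [^] k"
proof -
  have "x [^] k = x [^] (k div int p * int p) \<otimes> x [^] (k mod int p)"
    using assms(1) by (simp flip: int_pow_mult)
  then show ?thesis
    using assms int_pow_nat_pow_eq_id[of x p "k div int p * int p"] by simp
qed

text \<open>By Bezout \<open>k\<close> is invertible modulo \<open>p\<close>, so \<open>x\<close> is
  itself a power of \<open>x [^] k\<close>.\<close>

lemma (in group) mem_subgroup_of_coprime_pow:
  assumes S: "subgroup S G" and x: "x \<in> carrier G" "x [^] (p :: nat) = \<one>"
    and k: "x [^] (k :: int) \<in> S" "coprime k (int p)"
  shows "x \<in> S"
proof -
  obtain u v where "u * k + v * int p = gcd k (int p)"
    using bezout_int by blast
  then have "x = x [^] (u * k + v * int p)"
    using x(1) k(2) by simp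
  also have "\<dots> = (x [^] k) [^] u \<otimes> x [^] (v * int p)"
    using x(1) by (simp add: int_pow_mult int_pow_pow mult.commute)
  also have "x [^] (v * int p) = \<one>"
    using x by (rule int_pow_nat_pow_eq_id) simp
  finally show ?thesis
    using subgroup_int_pow_closed[OF S k(1), of u] x(1)
    by (metis int_pow_closed r_one)
qed

lemma coprime_if_between_0_prime:
  assumes "Factorial_Ring.prime (p :: nat)" "0 < k" "k < int p"
  shows "coprime k (int p)"
  using assms by (metis coprime_commute not_less prime_imp_coprime prime_nat_int_transfer zdvd_imp_le)

text \<open>A nonzero exponent below \<open>p\<close> is coprime to \<open>p\<close> and would force
  \<open>x\<close> into \<open>S\<close>. The kernel computations below remove one coordinate at a
  time in this way.\<close>

lemma (in group) mem_subgroup_of_pow: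
  assumes "Factorial_Ring.prime p" "subgroup S G" "x \<in> carrier G" "x [^] p = \<one>"
    and "x [^] (k :: int) \<in> S" "x \<notin> S" "k \<in> {0..<int p}"
  shows "k = 0"
  using assms mem_subgroup_of_coprime_pow[of S x p k] coprime_if_between_0_prime[of p k]
  by force

section \<open>Centralizers and centres of groups of prime power order\<close>

lemma (in group) card_subgroup_dvd_order: "subgroup H G \<Longrightarrow> card H dvd order G"
  using lagrange by (metis dvd_triv_right)

lemma (in group) subgroup_centralizer:
  assumes "x \<in> carrier G"
  shows "subgroup {g \<in> carrier G. g \<otimes> x = x \<otimes> g} G"
proof (rule subgroupI)
  fix g assume "g \<in> {g \<in> carrier G. g \<otimes> x = x \<otimes> g}"
  then have g: "g \<in> carrier G" "g \<otimes> x = x \<otimes> g" by auto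
  have "x \<otimes> inv g = inv g \<otimes> (g \<otimes> x) \<otimes> inv g"
    using g(1) assms by (simp add: m_assoc[symmetric])
  also have "\<dots> = inv g \<otimes> x"
    using g assms by (simp add: m_assoc)
  finally show "inv g \<in> {g \<in> carrier G. g \<otimes> x = x \<otimes> g}"
    using g(1) by simp
next
  fix g h assume "g \<in> {g \<in> carrier G. g \<otimes> x = x \<otimes> g}" "h \<in> {g \<in> carrier G. g \<otimes> x = x \<otimes> g}"
  then show "g \<otimes> h \<in> {g \<in> carrier G. g \<otimes> x = x \<otimes> g}"
    using assms by simp (metis m_assoc)
qed (use assms in auto)

lemma (in group) subgroup_center:
  "subgroup {g \<in> carrier G. \<forall>x \<in> carrier G. g \<otimes> x = x \<otimes> g} G"
proof -
  have "subgroup (\<Inter>x \<in> carrier G. {g \<in> carrier G. g \<otimes> x = x \<otimes> g}) G"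
    by (rule subgroups_Inter) (use subgroup_centralizer in auto)
  moreover have "(\<Inter>x \<in> carrier G. {g \<in> carrier G. g \<otimes> x = x \<otimes> g})
      = {g \<in> carrier G. \<forall>x \<in> carrier G. g \<otimes> x = x \<otimes> g}"
    using one_closed by auto
  ultimately show ?thesis by simp
qed

text \<open>Class equation: a trivial centre would make every conjugacy class other than that of the
  identity have size divisible by \<open>p\<close>.\<close>
lemma (in group) prime_power_center_nontrivial:
  assumes p: "Factorial_Ring.prime p" and ord: "order G = p ^ k" "k > 0"
  obtains c where "c \<in> carrier G" "c \<noteq> \<one>" "\<forall>g \<in> carrier G. c \<otimes> g = g \<otimes> c"
proof (rule ccontr)
  assume "\<not> thesis"
  with that have triv: "\<And>c. c \<in> carrier G \<Longrightarrow> \<forall>g \<in> carrier G. c \<otimes> g = g \<otimes> c \<Longrightarrow> c = \<one>"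
    by blast
  let ?\<phi> = "\<lambda>g. \<lambda>h \<in> carrier G. g \<otimes> h \<otimes> inv g"
  let ?O = "orbits G (carrier G) ?\<phi>"
  interpret act: group_action G "carrier G" ?\<phi>
    by (rule action_by_conjugation)
  have fin: "finite (carrier G)"
    using ord p by (metis order_gt_0_iff_finite prime_gt_0_nat zero_less_power)
  have finO: "finite ?O"
    using fin by (auto simp: orbits_def)
  have orb1: "orbit G ?\<phi> \<one> = {\<one>}"
    by (auto simp: orbit_def intro: exI[of _ \<one>])
  then have O1: "{\<one>} \<in> ?O"
    unfolding orbits_def using one_closed by force
  have dvd: "p dvd card Y" if Y: "Y \<in> ?O - {{\<one>}}" for Y
  proof -
    obtain x where x: "x \<in> carrier G" "Y = orbit G ?\<phi> x"
      using Y by (auto simp: orbits_def)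
    have "card Y dvd p ^ k"
      unfolding x(2) ord(1)[symmetric] act.orbit_stabilizer_theorem[OF x(1), symmetric] by simp
    then obtain i where i: "card Y = p ^ i"
      by (auto simp: divides_primepow_nat[OF p])
    \<comment> \<open>A conjugacy class with one element belongs to a central \<open>x\<close>,
      which \<open>triv\<close> makes the identity; but the class of the identity has been
      removed.\<close>
    have "i \<noteq> 0"
    proof
      assume "i = 0"
      then obtain y where y: "Y = {y}"
        using i by (auto simp: card_1_singleton_iff)
      have "x \<in> Y"
        using x act.orbit_refl by blast
      then have "Y = {x}" using y by auto
      then have "g \<otimes> x \<otimes> inv g = x" if "g \<in> carrier G" for g
        using that x by (auto simp: orbit_def)
      then have "\<forall>g \<in> carrier G. x \<otimes> g = g \<otimes> x"
        using x(1) by (metis inv_solve_right m_closed)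
      then have "x = \<one>" using triv x(1) by blast
      then show False
        using Y orb1 x(2) by auto
    qed
    then show ?thesis using i by simp
  qed
  have "(\<Sum>Y \<in> ?O. card Y) = order G"
    using act.disjoint_sum[OF fin, of "\<lambda>_. 1 :: nat"] by (simp add: order_def)
  then have sum: "1 + (\<Sum>Y \<in> ?O - {{\<one>}}. card Y) = p ^ k"
    using sum.remove[OF finO O1, of card] ord(1) by simp
  have "p dvd (\<Sum>Y \<in> ?O - {{\<one>}}. card Y)"
    using dvd by (rule dvd_sum)
  moreover have "p dvd 1 + (\<Sum>Y \<in> ?O - {{\<one>}}. card Y)"
    unfolding sum using ord(2) by simp
  ultimately have "p dvd 1"
    by (simp only: dvd_add_left_iff)
  then show False using p by simp
qed

text \<open>Two non-commuting elements would give a strict chain from the centre through the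
  centralizer of \<open>x\<close> to the whole group. Among divisors of \<open>p ^ 2\<close> this
  leaves order 1 for the centre, which is nontrivial by the class equation.\<close>

lemma (in group) commute_if_order_prime_square:
  assumes p: "Factorial_Ring.prime p" and ord: "order G = p ^ 2"
    and x: "x \<in> carrier G" and y: "y \<in> carrier G"
  shows "x \<otimes> y = y \<otimes> x"
proof (rule ccontr)
  assume xy: "x \<otimes> y \<noteq> y \<otimes> x"
  let ?C = "{g \<in> carrier G. g \<otimes> x = x \<otimes> g}"
  let ?Z = "{g \<in> carrier G. \<forall>h \<in> carrier G. g \<otimes> h = h \<otimes> g}"
  have fin: "finite (carrier G)"
    using ord p by (metis order_gt_0_iff_finite prime_gt_0_nat zero_less_power)
  have "x \<in> ?C - ?Z" using x y xy by auto
  then have "?Z \<subset> ?C" using x by auto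
  then have ZC: "card ?Z < card ?C"
    using fin by (intro psubset_card_mono) auto
  have "y \<notin> ?C" using xy by auto
  then have "?C \<subset> carrier G" using y by blast
  then have CG: "card ?C < p ^ 2"
    using fin ord by (metis order_def psubset_card_mono)
  have "card ?Z dvd p ^ 2" "card ?C dvd p ^ 2"
    using card_subgroup_dvd_order[OF subgroup_center]
      card_subgroup_dvd_order[OF subgroup_centralizer[OF x]] unfolding ord by simp_all
  then obtain i j where ij: "card ?Z = p ^ i" "card ?C = p ^ j"
    by (auto simp: divides_primepow_nat[OF p])
  then have "i < j" "j < 2"
    using ZC CG p prime_gt_1_nat[OF p] by (auto simp: power_strict_increasing_iff)
  then have "card ?Z = 1" using ij by simp
  then obtain z where z: "?Z = {z}" by (auto simp: card_1_singleton_iff)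
  obtain c where "c \<in> carrier G" "c \<noteq> \<one>" "\<forall>g \<in> carrier G. c \<otimes> g = g \<otimes> c"
    using prime_power_center_nontrivial[OF p ord] by auto
  then have "c \<in> ?Z" "\<one> \<in> ?Z" by auto
  then show False using z \<open>c \<noteq> \<one>\<close> by auto
qed

section \<open>Coordinates for the two groups of order \<open>p ^ 3\<close> and exponent
  \<open>p\<close>\<close>

text \<open>The kernel condition gives injectivity, and the equal finite cardinalities then give
  surjectivity. Explicit coordinate maps only need their kernel computed.\<close>

lemma is_iso_if_hom_trivial_kernel:
  assumes "group G" "group H" "f \<in> hom G H" "finite (carrier H)"
    and "card (carrier G) = card (carrier H)"
    and "\<And>x. x \<in> carrier G \<Longrightarrow> f x = \<one>\<^bsub>H\<^esub> \<Longrightarrow> x = \<one>\<^bsub>G\<^esub>"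
  shows "G \<cong> H"
proof -
  have inj: "inj_on f (carrier G)"
    using assms by (simp add: inj_on_one_iff')
  have "f ` carrier G \<subseteq> carrier H"
    using assms(3) by (auto simp: hom_def)
  then have "f ` carrier G = carrier H"
    using assms(4,5) inj by (simp add: card_image card_subset_eq)
  then show ?thesis
    using inj assms(3) by (auto simp: is_iso_def iso_def bij_betw_def)
qed

lemma card_elem_abelian_cube: "p > 0 \<Longrightarrow> card (carrier (elem_abelian_cube p)) = p ^ 3"
  by (simp add: carrier_integer_mod_group card_cartesian_product power3_eq_cube)

lemma card_heis_group: "card (carrier (heis_group p)) = p ^ 3"
  by (simp add: heis_group_carrier card_cartesian_product power3_eq_cube)

text \<open>Each of the \<open>i * j\<close> exchanges of one \<open>x\<close> with one
  \<open>y\<close> costs a factor \<open>z\<close>, which commutes with both. The induction on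
  \<open>i\<close> treats a single \<open>y\<close>; the induction on \<open>j\<close> then adds the
  others.\<close>

lemma (in group) nat_pow_swap_central:
  fixes i j :: nat
  assumes c: "x \<in> carrier G" "y \<in> carrier G" "z \<in> carrier G"
    and zc: "z \<otimes> x = x \<otimes> z" "z \<otimes> y = y \<otimes> z" and xy: "x \<otimes> y = y \<otimes> x \<otimes> z"
  shows "x [^] i \<otimes> y [^] j = y [^] j \<otimes> x [^] i \<otimes> z [^] (i * j)"
proof -
  have zx: "z [^] k \<otimes> x = x \<otimes> z [^] k" and zy: "z [^] k \<otimes> y = y \<otimes> z [^] k" for k :: nat
    using c zc by (simp_all add: group_commutes_pow)
  have 1: "x [^] i \<otimes> y = y \<otimes> x [^] i \<otimes> z [^] i"
  proof (induction i)
    case (Suc i)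
    have "x [^] Suc i \<otimes> y = x [^] i \<otimes> (x \<otimes> y)"
      using c by (simp add: m_assoc)
    also have "\<dots> = (x [^] i \<otimes> y) \<otimes> (x \<otimes> z)"
      using c by (simp add: xy m_assoc)
    also have "\<dots> = y \<otimes> x [^] i \<otimes> (z [^] i \<otimes> x) \<otimes> z"
      using c by (simp add: Suc m_assoc)
    also have "z [^] i \<otimes> x = x \<otimes> z [^] i"
      by (rule zx)
    finally show ?case using c by (simp add: m_assoc)
  qed (use c in simp)
  show ?thesis
  proof (induction j)
    case (Suc j)
    have "x [^] i \<otimes> y [^] Suc j = y [^] j \<otimes> x [^] i \<otimes> (z [^] (i * j) \<otimes> y)"
      using c Suc by (simp add: m_assoc[symmetric])
    also have "\<dots> = y [^] j \<otimes> (x [^] i \<otimes> y) \<otimes> z [^] (i * j)"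
      using c by (simp add: zy m_assoc)
    also have "\<dots> = y [^] Suc j \<otimes> x [^] i \<otimes> (z [^] i \<otimes> z [^] (i * j))"
      using c by (simp add: 1 m_assoc)
    also have "z [^] i \<otimes> z [^] (i * j) = z [^] (i * Suc j)"
      using c by (simp add: nat_pow_mult)
    finally show ?case .
  qed (use c in simp)
qed

text \<open>Every element has a normal form in \<open>y\<close>, \<open>x\<close> and
  \<open>z\<close>. Centralizers separate the coordinates: in a trivial product, the
  \<open>y\<close>-power centralizes \<open>x\<close> and must vanish, then the
  \<open>x\<close>-power centralizes \<open>y\<close> and must vanish.\<close>

lemma (in group) is_iso_heis_group:
  assumes p: "Factorial_Ring.prime p" and ord: "order G = p ^ 3"
    and c: "x \<in> carrier G" "y \<in> carrier G" "z \<in> carrier G"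
    and pw: "x [^] p = \<one>" "y [^] p = \<one>" "z [^] p = \<one>"
    and zc: "z \<otimes> x = x \<otimes> z" "z \<otimes> y = y \<otimes> z"
    and xy: "x \<otimes> y = y \<otimes> x \<otimes> z" and z1: "z \<noteq> \<one>"
  shows "heis_group p \<cong> G"
proof (rule is_iso_if_hom_trivial_kernel)
  \<comment> \<open>With the \<open>y\<close>-power in front, multiplying two such words moves
    \<open>x [^] a\<close> past \<open>y [^] b'\<close>, which produces exactly the summand
    \<open>a * b'\<close> of the Heisenberg product.\<close>
  let ?f = "\<lambda>(a :: int, b :: int, c :: int). y [^] b \<otimes> x [^] a \<otimes> z [^] c"
  show "group (heis_group p)"
    using p by (simp add: group_heis_group prime_gt_0_nat)
  show "finite (carrier G)"
    using ord p by (metis order_gt_0_iff_finite prime_gt_0_nat zero_less_power)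
  show "card (carrier (heis_group p)) = card (carrier G)"
    using ord by (simp add: card_heis_group order_def)
  have zx: "z [^] k \<otimes> x [^] l = x [^] l \<otimes> z [^] k"
    and zy: "z [^] k \<otimes> y [^] l = y [^] l \<otimes> z [^] k" for k l :: nat
    using c zc by (metis nat_pow_closed group_commutes_pow)+
  have zx_left: "z [^] k \<otimes> (x [^] l \<otimes> w) = x [^] l \<otimes> (z [^] k \<otimes> w)"
    if "w \<in> carrier G" for k l :: nat and w
    using that c zx[of k l] by (simp flip: m_assoc)
  show "?f \<in> hom (heis_group p) G"
  proof (rule homI)
    fix g h assume "g \<in> carrier (heis_group p)" "h \<in> carrier (heis_group p)"
    then obtain i j k i' j' k' :: nat where gh: "g = (int i, int j, int k)" "h = (int i', int j', int k')"
      by (auto simp: heis_group_carrier elim!: zero_le_imp_eq_int[THEN exE])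
    have "?f (g \<otimes>\<^bsub>heis_group p\<^esub> h) = y [^] (j + j') \<otimes> x [^] (i + i') \<otimes> z [^] (k + k' + i * j')"
      using c pw by (simp add: gh heis_group_mult int_pow_mod flip: int_pow_int)
    also have "k + k' + i * j' = i * j' + k + k'" by simp
    also have "y [^] (j + j') \<otimes> x [^] (i + i') \<otimes> z [^] (i * j' + k + k') =
        y [^] j \<otimes> (y [^] j' \<otimes> x [^] i \<otimes> (x [^] i' \<otimes> z [^] (i * j'))) \<otimes> z [^] k \<otimes> z [^] k'"
      using c by (simp add: m_assoc flip: nat_pow_mult)
    \<comment> \<open>The exchange rule is used backwards: \<open>z [^] (i * j')\<close> is absorbed
      when \<open>y [^] j'\<close> and \<open>x [^] i\<close> trade places.\<close>
    also have "\<dots> = y [^] j \<otimes> (x [^] i \<otimes> y [^] j') \<otimes> (x [^] i' \<otimes> z [^] k) \<otimes> z [^] k'"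
      using c by (simp add: nat_pow_swap_central[OF c zc xy] m_assoc zx zx_left)
    also have "\<dots> = y [^] j \<otimes> x [^] i \<otimes> (y [^] j' \<otimes> z [^] k) \<otimes> x [^] i' \<otimes> z [^] k'"
      using c by (simp add: m_assoc flip: zx)
    also have "\<dots> = ?f g \<otimes> ?f h"
      using c by (simp add: gh m_assoc int_pow_int flip: zy)
    finally show "?f (g \<otimes>\<^bsub>heis_group p\<^esub> h) = ?f g \<otimes> ?f h" .
  qed (use c in auto)
  fix g assume g: "g \<in> carrier (heis_group p)" and f1: "?f g = \<one>"
  obtain i j k where g_eq: "g = (i, j, k)" and
    ijk: "i \<in> {0..<int p}" "j \<in> {0..<int p}" "k \<in> {0..<int p}"
    using g by (auto simp: heis_group_carrier)
  let ?C = "\<lambda>x. {g \<in> carrier G. g \<otimes> x = x \<otimes> g}"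
  have yx: "y \<otimes> x \<noteq> x \<otimes> y"
  proof
    assume "y \<otimes> x = x \<otimes> y"
    then have "x \<otimes> y \<otimes> z = x \<otimes> y" using xy by simp
    then show False using c z1 by simp
  qed
  have Cx: "subgroup (?C x) G" and Cy: "subgroup (?C y) G"
    using c by (auto intro: subgroup_centralizer)
  have mem: "x [^] i \<in> ?C x" "z [^] k \<in> ?C x" "z [^] k \<in> ?C y"
    using subgroup_int_pow_closed[OF Cx] subgroup_int_pow_closed[OF Cy] c zc by auto
  have "y [^] j = inv (x [^] i \<otimes> z [^] k)"
    using f1 c unfolding g_eq by (simp add: m_assoc inv_equality)
  then have "y [^] j \<in> ?C x"
    using mem Cx by (simp only: subgroup.m_inv_closed subgroup.m_closed)
  then have j: "j = 0"
    using mem_subgroup_of_pow[OF p Cx] c pw yx ijk by auto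
  then have "x [^] i = inv (z [^] k)"
    using f1 c unfolding g_eq by (simp add: inv_equality)
  then have "x [^] i \<in> ?C y"
    using mem Cy by (simp only: subgroup.m_inv_closed)
  then have i: "i = 0"
    using mem_subgroup_of_pow[OF p Cy] c pw yx ijk by auto
  then have "z [^] k \<in> {\<one>}"
    using f1 c j unfolding g_eq by simp
  then have "k = 0"
    using mem_subgroup_of_pow[OF p triv_subgroup] c pw z1 ijk by auto
  then show "g = \<one>\<^bsub>heis_group p\<^esub>"
    using i j by (simp add: g_eq heis_group_one)
qed (rule is_group)

text \<open>A basis is chosen greedily: \<open>x\<close> outside the trivial subgroup,
  \<open>y\<close> outside the span of \<open>x\<close>, \<open>z\<close> outside the span of both.
  This is possible because these subgroups have at most 1, \<open>p\<close> and \<open>p * p\<close>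
  elements.\<close>

lemma (in comm_group) is_iso_elem_abelian_cube:
  assumes p: "Factorial_Ring.prime p" and ord: "order G = p ^ 3"
    and pw: "\<And>x. x \<in> carrier G \<Longrightarrow> x [^] p = \<one>"
  shows "elem_abelian_cube p \<cong> G"
proof -
  have p1: "p > 1" using p by (rule prime_gt_1_nat)
  have fin: "finite (carrier G)"
    using ord p by (metis order_gt_0_iff_finite prime_gt_0_nat zero_less_power)
  have outside: "\<exists>x \<in> carrier G. x \<notin> S" if "subgroup S G" "card S < p ^ 3" for S
    using that ord subgroup.subset[OF that(1)] by (metis less_irrefl order_def subsetI subset_antisym)
  have card_gen: "card (generate G {x}) \<le> p" if "x \<in> carrier G" for x
    using that pw[OF that] p1 by (metis dvd_imp_le generate_pow_card pow_eq_id less_trans zero_less_one)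
  obtain x where x: "x \<in> carrier G" "x \<notin> {\<one>}"
    using outside[OF triv_subgroup] one_less_power[OF p1, of 3] by auto
  let ?X = "generate G {x}"
  have X: "subgroup ?X G" using x by (intro generate_is_subgroup) auto
  have "card ?X < p ^ 3"
    using card_gen[OF x(1)] power_strict_increasing[of 1 3 p] p1 by simp
  then obtain y where y: "y \<in> carrier G" "y \<notin> ?X"
    using outside[OF X] by auto
  let ?Y = "?X <#> generate G {y}"
  have Y: "subgroup ?Y G"
    using x y by (intro mult_subgroups generate_is_subgroup) auto
  have "?Y = (\<lambda>(u, v). u \<otimes> v) ` (?X \<times> generate G {y})"
    by (auto simp: set_mult_def)
  moreover have "finite (?X \<times> generate G {y})"
    using fin x y generate_incl by (metis empty_subsetI finite_SigmaI insert_subset rev_finite_subset)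
  ultimately have "card ?Y \<le> card (?X \<times> generate G {y})"
    by (simp add: card_image_le)
  also have "\<dots> \<le> p * p"
    using card_gen x y by (simp add: card_cartesian_product mult_le_mono)
  also have "\<dots> < p ^ 3"
    using p1 by (simp add: power3_eq_cube)
  finally obtain z where z: "z \<in> carrier G" "z \<notin> ?Y"
    using outside[OF Y] by auto
  let ?f = "\<lambda>(a :: int, b :: int, c :: int). x [^] a \<otimes> y [^] b \<otimes> z [^] c"
  have c: "x \<in> carrier G" "y \<in> carrier G" "z \<in> carrier G"
    using x y z by auto
  show ?thesis
  proof (rule is_iso_if_hom_trivial_kernel)
    show "group (elem_abelian_cube p)" by (simp add: DirProd_group)
    show "card (carrier (elem_abelian_cube p)) = card (carrier G)"
      using card_elem_abelian_cube[of p] ord p1 by (simp add: order_def)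
    show "?f \<in> hom (elem_abelian_cube p) G"
    proof (rule homI)
      fix g h assume "g \<in> carrier (elem_abelian_cube p)" "h \<in> carrier (elem_abelian_cube p)"
      obtain i j k i' j' k' :: int where gh: "g = (i, j, k)" "h = (i', j', k')"
        by (cases g, cases h)
      show "?f (g \<otimes>\<^bsub>elem_abelian_cube p\<^esub> h) = ?f g \<otimes> ?f h"
        using c pw by (simp add: gh int_pow_mod int_pow_mult m_ac)
    qed (use c in auto)
    fix g assume g: "g \<in> carrier (elem_abelian_cube p)" and f1: "?f g = \<one>"
    obtain i j k where g_eq: "g = (i, j, k)" and
      ijk: "i \<in> {0..<int p}" "j \<in> {0..<int p}" "k \<in> {0..<int p}"
      using g p1 by (auto simp: carrier_integer_mod_group)
    \<comment> \<open>Coordinates are removed in the reverse order of choice, each basis element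
      lying outside the span of the earlier ones.\<close>
    have mem: "x [^] i \<in> ?X" "y [^] j \<in> generate G {y}"
      using generate_pow[OF c(1)] generate_pow[OF c(2)] by auto
    have "z [^] k = inv (x [^] i \<otimes> y [^] j)"
      using f1 c unfolding g_eq by (simp add: inv_equality m_comm)
    moreover have "x [^] i \<otimes> y [^] j \<in> ?Y"
      using mem by (auto simp: set_mult_def)
    ultimately have "z [^] k \<in> ?Y"
      using Y by (simp only: subgroup.m_inv_closed)
    then have k: "k = 0"
      using mem_subgroup_of_pow[OF p Y] z pw ijk by auto
    then have "y [^] j = inv (x [^] i)"
      using inv_equality[of "y [^] j" "x [^] i"] m_comm[of "y [^] j" "x [^] i"] f1 c
      unfolding g_eq by simp
    then have "y [^] j \<in> ?X"
      using mem X by (simp only: subgroup.m_inv_closed)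
    then have j: "j = 0"
      using mem_subgroup_of_pow[OF p X] y pw ijk by auto
    then have "x [^] i \<in> {\<one>}"
      using f1 c k unfolding g_eq by simp
    then have "i = 0"
      using mem_subgroup_of_pow[OF p triv_subgroup] x pw ijk by auto
    then show "g = \<one>\<^bsub>elem_abelian_cube p\<^esub>"
      using j k by (simp add: g_eq)
  qed (use fin is_group in auto)
qed

text \<open>The quotient by a central subgroup of order \<open>p\<close> is abelian, so all commutators lie in it.\<close>
lemma (in group) order_prime_cube_cases:
  assumes p: "Factorial_Ring.prime p" and ord: "order G = p ^ 3"
    and pw: "\<And>x. x \<in> carrier G \<Longrightarrow> x [^] p = \<one>"
  shows "elem_abelian_cube p \<cong> G \<or> heis_group p \<cong> G"
proof (cases "\<forall>x \<in> carrier G. \<forall>y \<in> carrier G. x \<otimes> y = y \<otimes> x")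
  case True
  then have "comm_group G"
    by (intro group_comm_groupI) auto
  then show ?thesis
    using comm_group.is_iso_elem_abelian_cube p ord pw by blast
next
  case False
  then obtain x y where xy: "x \<in> carrier G" "y \<in> carrier G" "x \<otimes> y \<noteq> y \<otimes> x" by blast
  obtain c where c: "c \<in> carrier G" "c \<noteq> \<one>" "\<forall>g \<in> carrier G. c \<otimes> g = g \<otimes> c"
    using prime_power_center_nontrivial[OF p ord] by auto
  let ?N = "generate G {c}"
  have N: "subgroup ?N G" using c by (intro generate_is_subgroup) auto
  have central: "n \<otimes> g = g \<otimes> n" if "n \<in> ?N" "g \<in> carrier G" for n g
  proof -
    have "?N \<subseteq> {g \<in> carrier G. \<forall>x \<in> carrier G. g \<otimes> x = x \<otimes> g}"
      using c by (intro generate_subgroup_incl subgroup_center) auto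
    then show ?thesis using that by auto
  qed
  have "?N \<lhd> G"
    using N central subgroup.mem_carrier[OF N] by (intro normalI) (auto simp: r_coset_def l_coset_def)
  then interpret N: normal ?N G .
  interpret Q: group "G Mod ?N" by (rule N.factorgroup_is_group)
  have "ord c dvd p" using pw[OF c(1)] pow_eq_id c(1) by blast
  moreover have "ord c \<noteq> 1" using c(1,2) pow_eq_id[of c 1] by auto
  ultimately have "card ?N = p"
    using p c(1) generate_pow_card by (metis prime_nat_iff)
  then have "card (rcosets ?N) * p = p ^ 3"
    using lagrange[OF N] ord by simp
  then have "order (G Mod ?N) = p ^ 2"
    using p by (simp add: order_def FactGroup_def power3_eq_cube power2_eq_square prime_gt_0_nat)
  then have "(?N #> x) <#> (?N #> y) = (?N #> y) <#> (?N #> x)"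
    using Q.commute_if_order_prime_square[OF p, of "?N #> x" "?N #> y"] xy(1,2)
    by (auto simp: FactGroup_def RCOSETS_def)
  then have "?N #> (x \<otimes> y) = ?N #> (y \<otimes> x)"
    using xy by (simp add: N.rcos_sum)
  then have "x \<otimes> y \<in> ?N #> (y \<otimes> x)"
    using xy rcos_self[OF _ N, of "x \<otimes> y"] by auto
  \<comment> \<open>This \<open>z\<close> is the commutator of \<open>x\<close> and \<open>y\<close>
    up to convention: central because it lies in \<open>?N\<close>, and nontrivial because
    \<open>x\<close> and \<open>y\<close> do not commute.\<close>
  then obtain z where z: "z \<in> ?N" "x \<otimes> y = z \<otimes> (y \<otimes> x)"
    by (auto simp: r_coset_def)
  have zG: "z \<in> carrier G" using z(1) N by (rule subgroup.mem_carrier[rotated])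
  have "heis_group p \<cong> G"
  proof (rule is_iso_heis_group[OF p ord xy(1,2) zG])
    show "x \<otimes> y = y \<otimes> x \<otimes> z" using z(2) central[OF z(1), of "y \<otimes> x"] xy by simp
    show "z \<noteq> \<one>" using z(2) xy by auto
  qed (use pw xy zG central z in auto)
  then show ?thesis ..
qed

section \<open>Splitting off a central cyclic factor of coprime order\<close>

lemma (in group) pow_card_subgroup_eq_1:
  assumes "subgroup P G" "x \<in> P"
  shows "x [^] card P = \<one>"
proof -
  interpret P: group "G\<lparr>carrier := P\<rparr>" by (rule subgroup.subgroup_is_group[OF assms(1) is_group])
  show ?thesis
    using P.pow_order_eq_1[of x] assms(2) by (simp add: order_def nat_pow_consistent[symmetric])
qed

lemma (in group) eq_one_if_coprime_pows:
  assumes "x \<in> carrier G" "x [^] (m :: nat) = \<one>" "x [^] (n :: nat) = \<one>" "coprime m n"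
  shows "x = \<one>"
proof -
  have "ord x dvd 1"
    using assms pow_eq_id by (metis coprime_common_divisor_nat dvd_refl)
  then show ?thesis
    using pow_eq_id[of x 1] assms(1) by simp
qed

text \<open>The map sends \<open>(x, k)\<close> to \<open>x \<otimes> u [^] k\<close>. It is a
  homomorphism since \<open>u\<close> commutes with \<open>P\<close>; in the kernel \<open>x\<close>
  is a power of \<open>u\<close>, hence killed by the coprime exponents \<open>ord u\<close> and
  \<open>card P\<close>.\<close>

lemma (in group) DirProd_central_complement_iso:
  assumes fin: "finite (carrier G)" and P: "subgroup P G" and u: "u \<in> carrier G"
    and comm: "\<And>x. x \<in> P \<Longrightarrow> u \<otimes> x = x \<otimes> u"
    and card: "card P * ord u = order G" and cop: "coprime (card P) (ord u)"
  shows "G\<lparr>carrier := P\<rparr> \<times>\<times> integer_mod_group (ord u) \<cong> G"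
proof (rule is_iso_if_hom_trivial_kernel)
  let ?H = "G\<lparr>carrier := P\<rparr> \<times>\<times> integer_mod_group (ord u)"
  let ?f = "\<lambda>(x, k :: int). x \<otimes> u [^] k"
  note PG = subgroup.mem_carrier[OF P]
  have pos: "ord u > 0" using ord_ge_1[OF fin u] by simp
  show "group ?H"
    using subgroup.subgroup_is_group[OF P is_group] by (simp add: DirProd_group)
  show "card (carrier ?H) = card (carrier G)"
    using card pos by (simp add: card_cartesian_product carrier_integer_mod_group order_def)
  have up: "x \<otimes> u [^] k = u [^] k \<otimes> x" if "x \<in> P" for x and k :: int
    using subgroup_int_pow_closed[OF subgroup_centralizer[OF PG[OF that]], of u k] u comm that by auto
  show "?f \<in> hom ?H G"
  proof (rule homI)
    fix g h assume gh: "g \<in> carrier ?H" "h \<in> carrier ?H"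
    obtain x k y l where eq: "g = (x, k)" "h = (y, l)" by (cases g, cases h)
    then have xy: "x \<in> P" "y \<in> P" using gh by auto
    have "?f (g \<otimes>\<^bsub>?H\<^esub> h) = x \<otimes> (y \<otimes> u [^] k) \<otimes> u [^] l"
      using u xy PG by (simp add: eq int_pow_mod int_pow_mult m_assoc)
    also have "\<dots> = ?f g \<otimes> ?f h"
      using u xy PG by (simp add: eq up[OF xy(2)] m_assoc)
    finally show "?f (g \<otimes>\<^bsub>?H\<^esub> h) = ?f g \<otimes> ?f h" .
  qed (use u PG in auto)
  fix g assume g: "g \<in> carrier ?H" and f1: "?f g = \<one>"
  obtain x k where eq: "g = (x, k)" by (cases g)
  have x: "x \<in> P" and k: "0 \<le> k" "k < int (ord u)"
    using g pos by (auto simp: eq carrier_integer_mod_group)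
  have xu: "x = inv (u [^] k)"
    using f1 x u PG by (simp add: eq inv_equality)
  then have "x = u [^] (- k)"
    using u by (simp add: int_pow_neg)
  then have "x [^] int (ord u) = u [^] (- k * int (ord u))"
    using u by (simp add: int_pow_pow)
  also have "\<dots> = \<one>"
    using u by (simp add: int_pow_eq_id)
  finally have "x [^] ord u = \<one>"
    by (simp add: int_pow_int)
  then have x1: "x = \<one>"
    using eq_one_if_coprime_pows[OF PG[OF x] pow_card_subgroup_eq_1[OF P x] _ cop] by simp
  then have "u [^] k = \<one>"
    using xu u by (metis int_pow_closed inv_inv inv_one)
  then have "k = 0"
    using u k by (simp add: int_pow_eq_id zdvd_not_zless order_le_less)
      (metis order_le_less zdvd_not_zless)
  then show "g = \<one>\<^bsub>?H\<^esub>"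
    using x1 eq by simp
qed (use fin is_group in auto)

section \<open>Groups whose cocyclic classes have order \<open>pn\<close>\<close>

text \<open>For a finite group these are the dominating vertices of the enhanced power
  graph.\<close>

definition cyclicizer :: "('a, 'b) monoid_scheme \<Rightarrow> 'a set" where
  "cyclicizer G = {d \<in> carrier G. \<forall>y \<in> carrier G. cocyclic G d y}"

lemma cyclicizerD: "d \<in> cyclicizer G \<Longrightarrow> y \<in> carrier G \<Longrightarrow> cocyclic G d y"
  by (simp add: cyclicizer_def)

lemma (in group) cocyclic_pow_left: "cocyclic G x y \<Longrightarrow> cocyclic G (x [^] (i :: nat)) y"
  by (metis cocyclic_def nat_pow_pow)

lemma (in group) cyclicizer_pow: "d \<in> cyclicizer G \<Longrightarrow> d [^] (i :: nat) \<in> cyclicizer G"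
  by (auto simp: cyclicizer_def cocyclic_pow_left)

lemma (in group) cocyclic_commute: "cocyclic G x y \<Longrightarrow> x \<otimes> y = y \<otimes> x"
  by (auto simp: cocyclic_def nat_pow_mult add.commute)

lemma (in group) cocyclic_if_mem_generate:
  assumes "finite (carrier G)" "g \<in> carrier G" "x \<in> generate G {g}" "y \<in> generate G {g}"
  shows "cocyclic G x y"
  using assms(3,4) assms(2)
  unfolding generate_pow_on_finite_carrier[OF assms(1,2)] by (auto intro: cocyclicI)

text \<open>A generator of maximal order in the class of \<open>x\<close> generates everything cocyclic with \<open>x\<close>.\<close>
lemma (in group) cocyclic_class_cyclic:
  assumes fin: "finite (carrier G)" and x: "x \<in> carrier G - cyclicizer G"
    and trans: "\<And>a b c. \<lbrakk>a \<in> carrier G - cyclicizer G; b \<in> carrier G - cyclicizer G;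
      c \<in> carrier G - cyclicizer G; cocyclic G a b; cocyclic G b c\<rbrakk> \<Longrightarrow> cocyclic G a c"
  obtains g where "g \<in> carrier G" "{y \<in> carrier G. cocyclic G x y} = generate G {g}"
proof -
  \<comment> \<open>Elements of the cyclicizer are left out because transitivity is available only
    outside it.\<close>
  let ?S = "{y \<in> carrier G - cyclicizer G. cocyclic G x y}"
  have "finite (ord ` ?S)" "ord ` ?S \<noteq> {}"
    using fin x cocyclic_refl by auto
  then have "Max (ord ` ?S) \<in> ord ` ?S" "\<And>h. h \<in> ?S \<Longrightarrow> ord h \<le> Max (ord ` ?S)"
    by (rule Max_in, simp)
  then obtain g where g: "g \<in> ?S" and max: "\<And>h. h \<in> ?S \<Longrightarrow> ord h \<le> ord g"
    by auto
  have sub: "y \<in> generate G {g}" if y: "y \<in> carrier G" "cocyclic G x y" for y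
  proof -
    have "cocyclic G g y"
    proof (cases "y \<in> cyclicizer G")
      case True
      then show ?thesis using g cyclicizerD[of y G g] cocyclic_sym[of G y g] by simp
    next
      case False
      then show ?thesis using trans[of g x y] g x y cocyclic_sym[of G x g] by simp
    qed
    then obtain h i j where h: "h \<in> carrier G" "g = h [^] (i :: nat)" "y = h [^] (j :: nat)"
      by (auto simp: cocyclic_def)
    \<comment> \<open>The cyclicizer is closed under powers and \<open>g\<close> is a power of
      \<open>h\<close>. So \<open>h\<close> also competes for the maximal order, and the subgroups
      of \<open>g\<close> and \<open>h\<close> coincide.\<close>
    have "h \<notin> cyclicizer G"
      using g h(2) cyclicizer_pow by blast
    moreover have gh: "cocyclic G g h"
      using cocyclicI[OF h(1), of i 1] h by simp
    ultimately have "h \<in> ?S"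
      using trans[of x g h] g h(1) x by simp
    then have "ord h \<le> ord g" by (rule max)
    moreover have "generate G {g} \<subseteq> generate G {h}"
    proof -
      have "g \<in> generate G {h}"
        using generate_pow_on_finite_carrier[OF fin h(1)] h(2) by auto
      then show ?thesis
        using h(1) by (intro generate_subgroup_incl generate_is_subgroup) auto
    qed
    moreover have "finite (generate G {h})"
      using fin h(1) generate_incl[of "{h}"] by (auto intro: finite_subset)
    ultimately have "generate G {g} = generate G {h}"
      using generate_pow_card g h(1) by (intro card_seteq) auto
    then show ?thesis
      using generate_pow_on_finite_carrier[OF fin h(1)] h(3) by auto
  qed
  have "{y \<in> carrier G. cocyclic G x y} = generate G {g}"
  proof (intro equalityI subsetI)
    fix y assume "y \<in> generate G {g}"
    then show "y \<in> {y \<in> carrier G. cocyclic G x y}"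
      using cocyclic_if_mem_generate[OF fin, of g x y] sub[of x] g x cocyclic_refl cocyclic_closed
      by blast
  qed (use sub in auto)
  then show thesis using g that by blast
qed

text \<open>The hypotheses other than those on \<open>p\<close> and \<open>n\<close> can be read off
  the graph. Classes are cyclic of order \<open>p * n\<close>, so the exponent of \<open>G\<close>
  divides \<open>p * n\<close>; the cyclicizer supplies the central factor of order
  \<open>n\<close>, and a Sylow \<open>p\<close>-subgroup supplies its complement.\<close>

lemma (in group) cyclicizer_structure:
  assumes fin: "finite (carrier G)" and p: "Factorial_Ring.prime p" and n: "n > 0" "coprime n p"
    and ord: "order G = p ^ 3 * n" and D: "card (cyclicizer G) = n"
    and card: "\<And>x. x \<in> carrier G - cyclicizer G \<Longrightarrow>
      card {y \<in> carrier G. cocyclic G x y} = p * n"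
    and trans: "\<And>a b c. \<lbrakk>a \<in> carrier G - cyclicizer G; b \<in> carrier G - cyclicizer G;
      c \<in> carrier G - cyclicizer G; cocyclic G a b; cocyclic G b c\<rbrakk> \<Longrightarrow> cocyclic G a c"
  obtains P where "subgroup P G" "card P = p ^ 3" "\<And>x. x \<in> P \<Longrightarrow> x [^] p = \<one>"
    "G\<lparr>carrier := P\<rparr> \<times>\<times> integer_mod_group n \<cong> G"
proof -
  let ?D = "cyclicizer G"
  have p1: "p > 1" using p by (rule prime_gt_1_nat)
  have finD: "finite ?D" using fin by (simp add: cyclicizer_def)
  have cls: "\<exists>g \<in> carrier G. {y \<in> carrier G. cocyclic G x y} = generate G {g} \<and> ord g = p * n"
    if x: "x \<in> carrier G - ?D" for x
  proof -
    obtain g where "g \<in> carrier G" "{y \<in> carrier G. cocyclic G x y} = generate G {g}"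
      by (rule cocyclic_class_cyclic[OF fin x], rule trans)
    then show ?thesis using card[OF x] generate_pow_card by auto
  qed
  have "?D \<noteq> carrier G"
  proof
    assume "?D = carrier G"
    then have "p ^ 3 * n = n" using D ord by (metis order_def)
    moreover have "1 < p ^ 3" using p1 by (rule one_less_power) simp
    ultimately show False using n(1) by simp
  qed
  then obtain x where x: "x \<in> carrier G - ?D"
    by (auto simp: cyclicizer_def)
  then obtain g where g: "g \<in> carrier G" "{y \<in> carrier G. cocyclic G x y} = generate G {g}"
    "ord g = p * n"
    using cls by blast
  have D_class: "?D \<subseteq> {y \<in> carrier G. cocyclic G x y}" if "x \<in> carrier G - ?D" for x
    using that cyclicizerD cocyclic_sym by (fastforce simp: cyclicizer_def)
  have D_mult: "d \<otimes> e \<in> ?D" if d: "d \<in> ?D" "e \<in> ?D" for d e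
  proof -
    have "cocyclic G (d \<otimes> e) y" if y: "y \<in> carrier G" for y
    proof -
      \<comment> \<open>A single cyclic subgroup contains \<open>d\<close>, \<open>e\<close> and
        \<open>y\<close>: the class of \<open>y\<close> if \<open>y\<close> is not dominating, and
        otherwise any class, since each contains the whole cyclicizer.\<close>
      obtain h where "h \<in> carrier G" and h: "d \<in> generate G {h}" "e \<in> generate G {h}" "y \<in> generate G {h}"
      proof (cases "y \<in> ?D")
        case True
        then show ?thesis using that[OF g(1)] D_class[OF x] d unfolding g(2) by blast
      next
        case False
        then obtain h where "h \<in> carrier G" "{z \<in> carrier G. cocyclic G y z} = generate G {h}"
          using cls[of y] y by blast
        moreover have "y \<in> {z \<in> carrier G. cocyclic G y z}"
          using y cocyclic_refl by simp
        ultimately show ?thesis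
          using that[of h] D_class[of y] d y False by blast
      qed
      then have "d \<otimes> e \<in> generate G {h}"
        by (intro subgroup.m_closed[OF generate_is_subgroup]) auto
      then show ?thesis
        using cocyclic_if_mem_generate[OF fin \<open>h \<in> carrier G\<close>] h by blast
    qed
    then show ?thesis using d by (simp add: cyclicizer_def)
  qed
  have oneD: "\<one> \<in> ?D"
  proof -
    obtain d where "d \<in> ?D" using D n(1) by fastforce
    then show ?thesis using cyclicizer_pow[of d 0] by simp
  qed
  have subD: "subgroup ?D G"
  proof (rule subgroupI)
    fix d assume d: "d \<in> ?D"
    then have dG: "d \<in> carrier G" by (simp add: cyclicizer_def)
    \<comment> \<open>The inverse is a natural power because \<open>ord d\<close> is at least 1 in a
      finite group.\<close>
    have "d [^] (ord d - 1) \<otimes> d = d [^] (ord d - 1 + 1)"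
      using dG by simp
    also have "ord d - 1 + 1 = ord d"
      using ord_ge_1[OF fin dG] by simp
    finally have "inv d = d [^] (ord d - 1)"
      using dG by (simp add: inv_equality)
    then show "inv d \<in> ?D" using cyclicizer_pow[OF d] by simp
  qed (use oneD D_mult in \<open>auto simp: cyclicizer_def\<close>)
  have D_pow: "d [^] n = \<one>" if "d \<in> ?D" for d
    using pow_card_subgroup_eq_1[OF subD that] D by simp
  \<comment> \<open>In the cyclic group of order \<open>p * n\<close> generated by \<open>g\<close>,
    the \<open>p\<close>-th power generates the subgroup of order \<open>n\<close>. The cyclicizer
    is that subgroup: its elements are killed by \<open>n\<close>, so their exponents over
    \<open>g\<close> are multiples of \<open>p\<close>.\<close>
  define u where "u = g [^] p"
  have u: "u \<in> carrier G" "ord u = n"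
    using g ord_pow[of g p] p1 by (auto simp: u_def)
  have "?D \<subseteq> generate G {u}"
  proof
    fix d assume d: "d \<in> ?D"
    then have "d \<in> generate G {g}"
      using D_class[OF x] g(2) by blast
    then obtain k :: nat where k: "d = g [^] k"
      unfolding generate_pow_on_finite_carrier[OF fin g(1)] by blast
    then have "p * n dvd k * n"
      using D_pow[OF d] g by (simp add: nat_pow_pow pow_eq_id)
    then obtain l where "k = p * l"
      using n(1) by auto
    then have "d = u [^] l"
      using g(1) k by (simp add: u_def nat_pow_pow)
    then show "d \<in> generate G {u}"
      unfolding generate_pow_on_finite_carrier[OF fin u(1)] by blast
  qed
  moreover have "finite (generate G {u})"
    using fin u(1) generate_incl[of "{u}"] by (auto intro: finite_subset)
  ultimately have "?D = generate G {u}"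
    using D u generate_pow_card[OF u(1)] by (intro card_subset_eq) auto
  then have uD: "u \<in> ?D" by (auto intro: generate.incl)
  have exponent: "y [^] (p * n) = \<one>" if y: "y \<in> carrier G" for y
  proof (cases "y \<in> ?D")
    case True
    then show ?thesis
      using D_pow[OF True] y by (metis mult.commute nat_pow_one nat_pow_pow)
  next
    case False
    then obtain h where h: "h \<in> carrier G" "{z \<in> carrier G. cocyclic G y z} = generate G {h}"
      "ord h = p * n"
      using cls[of y] y by blast
    then have "y \<in> generate G {h}"
      using y cocyclic_refl by blast
    then obtain k :: nat where "y = h [^] k"
      unfolding generate_pow_on_finite_carrier[OF fin h(1)] by blast
    then show ?thesis
      using h by (simp add: nat_pow_pow pow_eq_id)
  qed
  obtain P where P: "subgroup P G" "card P = p ^ 3"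
    using sylow_thm[OF p is_group ord fin] by blast
  \<comment> \<open>\<open>y [^] p\<close> is killed by \<open>n\<close>, by the exponent bound, and
    by \<open>p ^ 3\<close>, by Lagrange; these numbers are coprime.\<close>
  have Pp: "y [^] p = \<one>" if y: "y \<in> P" for y
  proof -
    have yG: "y \<in> carrier G" using P(1) y by (rule subgroup.mem_carrier)
    have "(y [^] p) [^] n = \<one>"
      using exponent[OF yG] yG by (simp add: nat_pow_pow)
    moreover have "(y [^] p) [^] (p ^ 3) = \<one>"
      using pow_card_subgroup_eq_1[OF P(1) y] P(2) yG
      by (metis mult.commute nat_pow_one nat_pow_pow)
    ultimately show ?thesis
      using eq_one_if_coprime_pows[of "y [^] p" n "p ^ 3"] n(2) yG by simp
  qed
  have "G\<lparr>carrier := P\<rparr> \<times>\<times> integer_mod_group (ord u) \<cong> G"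
  proof (rule DirProd_central_complement_iso[OF fin P(1) u(1)])
    show "u \<otimes> y = y \<otimes> u" if "y \<in> P" for y
      using cocyclic_commute cyclicizerD[OF uD] subgroup.mem_carrier[OF P(1) that] by blast
    show "coprime (card P) (ord u)"
      using n(2) u(2) P(2) by (simp add: coprime_commute)
  qed (use ord u P in simp)
  then show thesis
    using that P Pp u(2) by blast
qed

section \<open>Cocyclic pairs in products of coprime exponents\<close>

lemma (in group) nat_pow_cong:
  assumes "x \<in> carrier G" "x [^] (p :: nat) = \<one>" "[i = j] (mod p)"
  shows "x [^] i = x [^] j"
proof -
  have "x [^] (int i mod int p) = x [^] (int j mod int p)"
    using assms(3) by (simp add: cong_def zmod_int[symmetric])
  then show ?thesis
    using assms(1,2) by (simp add: int_pow_mod int_pow_int)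
qed

text \<open>The Chinese remainder theorem merges the separate exponents over \<open>z\<close> and
  \<open>w\<close> into common exponents over \<open>(z, w)\<close>.\<close>

lemma cocyclic_DirProd_coprime:
  assumes "group G" "group H" "coprime p n"
    and exponent: "\<And>x. x \<in> carrier G \<Longrightarrow> x [^]\<^bsub>G\<^esub> (p :: nat) = \<one>\<^bsub>G\<^esub>"
      "\<And>y. y \<in> carrier H \<Longrightarrow> y [^]\<^bsub>H\<^esub> (n :: nat) = \<one>\<^bsub>H\<^esub>"
  shows "cocyclic (G \<times>\<times> H) (a, b) (c, d) \<longleftrightarrow> cocyclic G a c \<and> cocyclic H b d"
proof
  interpret G: group G by fact
  interpret H: group H by fact
  show "cocyclic (G \<times>\<times> H) (a, b) (c, d) \<Longrightarrow> cocyclic G a c \<and> cocyclic H b d"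
    by (auto simp: cocyclic_def nat_pow_DirProd)
  assume "cocyclic G a c \<and> cocyclic H b d"
  then obtain z w i j k l
    where z: "z \<in> carrier G" "a = z [^]\<^bsub>G\<^esub> (i :: nat)" "c = z [^]\<^bsub>G\<^esub> (j :: nat)"
      and w: "w \<in> carrier H" "b = w [^]\<^bsub>H\<^esub> (k :: nat)" "d = w [^]\<^bsub>H\<^esub> (l :: nat)"
    by (auto simp: cocyclic_def)
  obtain r where r: "[r = i] (mod p)" "[r = k] (mod n)"
    using binary_chinese_remainder_nat[OF assms(3)] by blast
  obtain s where s: "[s = j] (mod p)" "[s = l] (mod n)"
    using binary_chinese_remainder_nat[OF assms(3)] by blast
  have "(a, b) = (z, w) [^]\<^bsub>G \<times>\<times> H\<^esub> r" "(c, d) = (z, w) [^]\<^bsub>G \<times>\<times> H\<^esub> s"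
    using G.nat_pow_cong[OF z(1) exponent(1)] H.nat_pow_cong[OF w(1) exponent(2)] r s z w
    by (auto simp: nat_pow_DirProd)
  then show "cocyclic (G \<times>\<times> H) (a, b) (c, d)"
    using z(1) w(1) cocyclicI[of "(z, w)" "G \<times>\<times> H" r s] by simp
qed

lemma cocyclic_integer_mod_group:
  assumes "n > 0" "x \<in> carrier (integer_mod_group n)" "y \<in> carrier (integer_mod_group n)"
  shows "cocyclic (integer_mod_group n) x y"
proof -
  \<comment> \<open>The reduced generator \<open>1 mod int n\<close> also covers
    \<open>n = 1\<close>, where the carrier is \<open>{0}\<close>.\<close>
  have "z = (1 mod int n) [^]\<^bsub>integer_mod_group n\<^esub> nat z" if "z \<in> carrier (integer_mod_group n)" for z
    using that assms(1) by (auto simp: carrier_integer_mod_group mod_simps)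
  moreover have "1 mod int n \<in> carrier (integer_mod_group n)"
    using assms(1) by (simp add: carrier_integer_mod_group)
  ultimately show ?thesis
    using assms(2,3) unfolding cocyclic_def by blast
qed

lemma pow_integer_mod_group_self:
  "x [^]\<^bsub>integer_mod_group n\<^esub> n = \<one>\<^bsub>integer_mod_group n\<^esub>"
  by simp

text \<open>If \<open>a = z [^] i\<close> is not the identity, then \<open>p\<close> does not divide
  \<open>i\<close>, so \<open>z\<close> is in turn a power of \<open>a\<close>. Hence
  \<open>generate G {a}\<close> is the only cyclic subgroup containing \<open>a\<close>.\<close>

lemma (in group) cocyclic_iff_mem_generate:
  fixes p :: nat
  assumes fin: "finite (carrier G)" and p: "Factorial_Ring.prime p"
    and pw: "\<And>x. x \<in> carrier G \<Longrightarrow> x [^] p = \<one>"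
    and a: "a \<in> carrier G" "a \<noteq> \<one>"
  shows "cocyclic G a c \<longleftrightarrow> c \<in> generate G {a}"
proof
  assume "cocyclic G a c"
  then obtain z i j where z: "z \<in> carrier G" "a = z [^] (i :: nat)" "c = z [^] (j :: nat)"
    by (auto simp: cocyclic_def)
  have S: "subgroup (generate G {a}) G" using a by (intro generate_is_subgroup) auto
  have "\<not> p dvd i"
    using z(1,2) a(2) pw[OF z(1)] pow_eq_id dvd_trans by blast
  then have "coprime (int i) (int p)"
    using prime_imp_coprime[OF p, of i] by (simp add: coprime_commute)
  moreover have "z [^] int i \<in> generate G {a}"
    using z(2) by (auto simp: int_pow_int intro: generate.incl)
  ultimately have "z \<in> generate G {a}"
    using mem_subgroup_of_coprime_pow[OF S z(1) pw[OF z(1)]] by blast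
  then show "c \<in> generate G {a}"
    using subgroup_int_pow_closed[OF S, of z "int j"] z(3) by (simp add: int_pow_int)
next
  assume "c \<in> generate G {a}"
  then show "cocyclic G a c"
    using cocyclic_if_mem_generate[OF fin a(1), of a c] by (auto intro: generate.incl)
qed

section \<open>The product of a group of exponent \<open>p\<close> with a cyclic group\<close>

text \<open>Order and exponent of \<open>E\<close> already determine the graph data needed about its
  product with the cyclic group of order \<open>n\<close>. The locale is interpreted below with the
  elementary abelian cube.\<close>

locale prime_cube_exponent_group = group E for E (structure) +
  fixes p n :: nat
  assumes p: "Factorial_Ring.prime p" and ord: "order E = p ^ 3"
    and pw: "\<And>x. x \<in> carrier E \<Longrightarrow> x [^] p = \<one>"
    and n: "n > 0" "coprime n p"
begin

lemma finite_carrier: "finite (carrier E)"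
  using ord p by (metis order_gt_0_iff_finite prime_gt_0_nat zero_less_power)

lemma cocyclic_DirProd_cyclic:
  "cocyclic (E \<times>\<times> integer_mod_group n) (a, b) (c, d) \<longleftrightarrow>
    cocyclic E a c \<and> b \<in> carrier (integer_mod_group n) \<and> d \<in> carrier (integer_mod_group n)"
  using cocyclic_DirProd_coprime[OF is_group group_integer_mod_group[of n] _ pw pow_integer_mod_group_self, of a b c d]
    n group.cocyclic_closed[OF group_integer_mod_group] cocyclic_integer_mod_group[OF n(1)]
  by (metis coprime_commute)

lemma card_generate_singleton:
  assumes "a \<in> carrier E" "a \<noteq> \<one>\<^bsub>E\<^esub>"
  shows "card (generate E {a}) = p"
proof -
  have "ord a dvd p" using pw[OF assms(1)] pow_eq_id assms(1) by blast
  moreover have "ord a \<noteq> 1" using assms pow_eq_id[of a 1] by auto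
  ultimately show ?thesis
    using p generate_pow_card[OF assms(1)] by (metis prime_nat_iff)
qed

text \<open>A first component other than the identity would have to generate all of
  \<open>E\<close>, but it generates only \<open>p\<close> elements.\<close>

lemma cyclicizer_DirProd_cyclic:
  "cyclicizer (E \<times>\<times> integer_mod_group n) = {\<one>\<^bsub>E\<^esub>} \<times> carrier (integer_mod_group n)"
proof -
  have "cocyclic E \<one>\<^bsub>E\<^esub> y" if "y \<in> carrier E" for y
    using cocyclicI[OF that, of 0 1] that by simp
  moreover have "a = \<one>\<^bsub>E\<^esub>" if a: "a \<in> carrier E" "\<forall>y \<in> carrier E. cocyclic E a y" for a
  proof (rule ccontr)
    assume a1: "a \<noteq> \<one>\<^bsub>E\<^esub>"
    then have "carrier E \<subseteq> generate E {a}"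
      using a cocyclic_iff_mem_generate[OF finite_carrier p pw] by auto
    then have "card (carrier E) \<le> card (generate E {a})"
      using finite_carrier a(1) generate_incl[of "{a}"] by (intro card_mono) (auto intro: finite_subset)
    then have "p ^ 3 \<le> p ^ 1"
      using card_generate_singleton[OF a(1) a1] ord by (simp add: order_def)
    then show False
      using power_strict_increasing[of 1 3 p] prime_gt_1_nat[OF p] by simp
  qed
  moreover have "0 \<in> carrier (integer_mod_group n)" by simp
  ultimately show ?thesis
    by (auto simp: cyclicizer_def cocyclic_DirProd_cyclic)
qed

text \<open>The class of \<open>(a, b)\<close> is the subgroup generated by \<open>a\<close> times
  the full cyclic factor.\<close>

lemma card_cocyclic_class_DirProd_cyclic:
  assumes "x \<in> carrier (E \<times>\<times> integer_mod_group n) - cyclicizer (E \<times>\<times> integer_mod_group n)"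
  shows "card {y \<in> carrier (E \<times>\<times> integer_mod_group n). cocyclic (E \<times>\<times> integer_mod_group n) x y} = p * n"
proof -
  obtain a b where x: "x = (a, b)" by (cases x)
  then have ab: "a \<in> carrier E" "a \<noteq> \<one>\<^bsub>E\<^esub>" "b \<in> carrier (integer_mod_group n)"
    using assms by (auto simp: cyclicizer_DirProd_cyclic)
  have "{y \<in> carrier (E \<times>\<times> integer_mod_group n). cocyclic (E \<times>\<times> integer_mod_group n) x y}
      = generate E {a} \<times> carrier (integer_mod_group n)"
    using ab cocyclic_iff_mem_generate[OF finite_carrier p pw] generate_incl[of "{a}"]
    by (auto simp: x cocyclic_DirProd_cyclic)
  then show ?thesis
    using card_generate_singleton[OF ab(1,2)] n by (simp add: card_cartesian_product carrier_integer_mod_group)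
qed

text \<open>The middle element has a nontrivial first component \<open>c\<close>, so being cocyclic
  with it means lying in \<open>generate E {c}\<close>, which is contained in
  \<open>generate E {a}\<close>.\<close>

lemma cocyclic_trans_DirProd_cyclic:
  assumes "x \<in> carrier (E \<times>\<times> integer_mod_group n) - cyclicizer (E \<times>\<times> integer_mod_group n)"
    and "y \<in> carrier (E \<times>\<times> integer_mod_group n) - cyclicizer (E \<times>\<times> integer_mod_group n)"
    and "cocyclic (E \<times>\<times> integer_mod_group n) x y" "cocyclic (E \<times>\<times> integer_mod_group n) y z"
  shows "cocyclic (E \<times>\<times> integer_mod_group n) x z"
proof -
  obtain a b c d e f where eq: "x = (a, b)" "y = (c, d)" "z = (e, f)"
    by (cases x, cases y, cases z)
  have ac: "a \<in> carrier E" "a \<noteq> \<one>\<^bsub>E\<^esub>" "c \<in> carrier E" "c \<noteq> \<one>\<^bsub>E\<^esub>"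
    using assms(1,2) by (auto simp: eq cyclicizer_DirProd_cyclic)
  have "c \<in> generate E {a}" "e \<in> generate E {c}"
    using assms(3,4) ac cocyclic_iff_mem_generate[OF finite_carrier p pw]
    by (auto simp: eq cocyclic_DirProd_cyclic)
  moreover have "generate E {c} \<subseteq> generate E {a}"
    using calculation(1) ac by (intro generate_subgroup_incl generate_is_subgroup) auto
  ultimately have "cocyclic E a e"
    using cocyclic_iff_mem_generate[OF finite_carrier p pw ac(1,2)] by auto
  then show ?thesis
    using assms(3,4) by (auto simp: eq cocyclic_DirProd_cyclic)
qed

text \<open>The graph isomorphism transports the order, the number of dominating vertices, the class
  sizes and transitivity from the product to \<open>G\<close>, which is the input of
  \<open>cyclicizer_structure\<close>.\<close>

lemma epg_iso_imp_sylow_structure: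
  fixes G :: "('c, 'd) monoid_scheme"
  assumes G: "group G" "finite (carrier G)" and iso: "epg_iso G (E \<times>\<times> integer_mod_group n)"
  obtains P where "subgroup P G" "card P = p ^ 3"
    "\<And>x. x \<in> P \<Longrightarrow> x [^]\<^bsub>G\<^esub> p = \<one>\<^bsub>G\<^esub>"
    "G\<lparr>carrier := P\<rparr> \<times>\<times> integer_mod_group n \<cong> G"
proof -
  interpret G: group G by fact
  let ?H = "E \<times>\<times> integer_mod_group n"
  interpret H: group ?H by (simp add: DirProd_group)
  have cardH: "card (carrier ?H) = p ^ 3 * n"
    using ord n by (simp add: card_cartesian_product carrier_integer_mod_group order_def)
  have finH: "finite (carrier ?H)"
    using finite_carrier n by (simp add: carrier_integer_mod_group)
  obtain f where bij: "bij_betw f (carrier G) (carrier ?H)"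
    and adj: "\<And>x y. x \<in> carrier G \<Longrightarrow> y \<in> carrier G \<Longrightarrow> epg_adj G x y \<longleftrightarrow> epg_adj ?H (f x) (f y)"
    using iso unfolding epg_iso_def by blast
  have inj: "inj_on f (carrier G)" and im: "f ` carrier G = carrier ?H"
    using bij by (auto simp: bij_betw_def)
  \<comment> \<open>The graph has no loops, but equal elements are cocyclic on both sides, so
    adjacency determines the whole relation.\<close>
  have coc: "cocyclic G x y \<longleftrightarrow> cocyclic ?H (f x) (f y)" if xy: "x \<in> carrier G" "y \<in> carrier G" for x y
  proof (cases "x = y")
    case True
    have "f x \<in> carrier ?H" using xy(1) unfolding im[symmetric] by (rule imageI)
    then show ?thesis
      using True H.cocyclic_refl G.cocyclic_refl[OF xy(1)] by blast
  next
    case False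
    then have "f x \<noteq> f y" using xy inj by (auto dest: inj_onD)
    then show ?thesis
      using adj[OF xy] False by (simp add: epg_adj_iff_cocyclic[OF G] epg_adj_iff_cocyclic[OF H.is_group finH])
  qed
  have cyc_iff: "x \<in> cyclicizer G \<longleftrightarrow> f x \<in> cyclicizer ?H" if "x \<in> carrier G" for x
    using coc that unfolding cyclicizer_def im[symmetric] by auto
  have "f ` cyclicizer G = cyclicizer ?H"
  proof (intro equalityI subsetI)
    fix y assume "y \<in> cyclicizer ?H"
    moreover then obtain x where "x \<in> carrier G" "y = f x"
      unfolding cyclicizer_def im[symmetric] by blast
    ultimately show "y \<in> f ` cyclicizer G" using cyc_iff by blast
  qed (use cyc_iff in \<open>auto simp: cyclicizer_def[of G]\<close>)
  moreover have "inj_on f (cyclicizer G)"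
    using inj by (rule inj_on_subset) (auto simp: cyclicizer_def)
  ultimately have "card (cyclicizer G) = card (cyclicizer ?H)"
    by (metis card_image)
  then have card_cyc: "card (cyclicizer G) = n"
    using n by (simp add: cyclicizer_DirProd_cyclic card_cartesian_product carrier_integer_mod_group)
  have out: "f x \<in> carrier ?H - cyclicizer ?H" if "x \<in> carrier G - cyclicizer G" for x
    using that cyc_iff[of x] unfolding im[symmetric] by simp
  have card_class: "card {y \<in> carrier G. cocyclic G x y} = p * n"
    if x: "x \<in> carrier G - cyclicizer G" for x
  proof -
    have "f ` {y \<in> carrier G. cocyclic G x y} = {y \<in> carrier ?H. cocyclic ?H (f x) y}"
    proof -
      have "cocyclic G x y \<longleftrightarrow> cocyclic ?H (f x) (f y)" if "y \<in> carrier G" for y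
        using coc x that by blast
      then show ?thesis unfolding im[symmetric] by blast
    qed
    moreover have "inj_on f {y \<in> carrier G. cocyclic G x y}"
      using inj by (rule inj_on_subset) auto
    then have "card (f ` {y \<in> carrier G. cocyclic G x y}) = card {y \<in> carrier G. cocyclic G x y}"
      by (rule card_image)
    ultimately show ?thesis
      using card_cocyclic_class_DirProd_cyclic[OF out[OF x]] by simp
  qed
  have trans: "cocyclic G a c"
    if "a \<in> carrier G - cyclicizer G" "b \<in> carrier G - cyclicizer G" "c \<in> carrier G - cyclicizer G"
      "cocyclic G a b" "cocyclic G b c" for a b c
    using cocyclic_trans_DirProd_cyclic[OF out[OF that(1)] out[OF that(2)], of "f c"] that
      coc[of a b] coc[of b c] coc[of a c] by simp
  have ordG: "order G = p ^ 3 * n"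
    using bij_betw_same_card[OF bij] cardH by (simp add: order_def)
  show thesis
  proof (rule G.cyclicizer_structure[OF G(2) p n ordG card_cyc card_class])
    fix P assume "subgroup P G" "card P = p ^ 3" "\<And>x. x \<in> P \<Longrightarrow> x [^]\<^bsub>G\<^esub> p = \<one>\<^bsub>G\<^esub>"
      "G\<lparr>carrier := P\<rparr> \<times>\<times> integer_mod_group n \<cong> G"
    then show thesis by (rule that)
  next
    fix a b c
    assume "a \<in> carrier G - cyclicizer G" "b \<in> carrier G - cyclicizer G"
      "c \<in> carrier G - cyclicizer G" "cocyclic G a b" "cocyclic G b c"
    then show "cocyclic G a c" by (rule trans)
  qed
qed

end

section \<open>Graph isomorphism and group isomorphism compared\<close>

text \<open>The target group is a right-nested product of four factors, while the arguments above
  treat the first three as one factor.\<close>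

lemma DirProd_assoc_iso:
  "(G \<times>\<times> H \<times>\<times> I) \<times>\<times> J \<cong> G \<times>\<times> H \<times>\<times> I \<times>\<times> J"
proof -
  have "(\<lambda>((x, y, z), w). (x, y, z, w)) \<in> iso ((G \<times>\<times> H \<times>\<times> I) \<times>\<times> J) (G \<times>\<times> H \<times>\<times> I \<times>\<times> J)"
    by (auto simp: iso_def hom_def bij_betw_def inj_on_def image_iff)
  then show ?thesis by (auto simp: is_iso_def)
qed

theorem theorem8:
  fixes G :: "('a, 'b) monoid_scheme" and p n :: nat
  assumes "group G" and "finite (carrier G)"
    and "Factorial_Ring.prime p" and "p > 2" and "n > 0" and "coprime n p"
  shows "epg_iso G (integer_mod_group p \<times>\<times> integer_mod_group p \<times>\<times> integer_mod_group p
                      \<times>\<times> integer_mod_group n)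
     \<longleftrightarrow> (G \<cong> (integer_mod_group p \<times>\<times> integer_mod_group p \<times>\<times> integer_mod_group p
                      \<times>\<times> integer_mod_group n)
          \<or> G \<cong> (heis_group p \<times>\<times> integer_mod_group n))"
    (is "epg_iso G ?M \<longleftrightarrow> _")
proof -
  interpret G: group G by fact
  have p0: "p > 0" and oddp: "odd p"
    using assms(3,4) by (auto simp: prime_gt_0_nat prime_odd_nat)
  let ?A = "elem_abelian_cube p" and ?K = "heis_group p" and ?Z = "integer_mod_group n"
  have gA: "group ?A" and gM: "group ?M" by (simp_all add: DirProd_group)
  have gAZ: "group (?A \<times>\<times> ?Z)" by (simp add: DirProd_group)
  have gK: "group ?K" using p0 by (rule group_heis_group)
  then have gKZ: "group (?K \<times>\<times> ?Z)" by (simp add: DirProd_group)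
  have AM: "?A \<times>\<times> ?Z \<cong> ?M" by (rule DirProd_assoc_iso)
  show ?thesis
  proof (intro iffI)
    assume "G \<cong> ?M \<or> G \<cong> ?K \<times>\<times> ?Z"
    then show "epg_iso G ?M"
    proof
      assume "G \<cong> ?M"
      then show ?thesis
        using pow_bij_imp_epg_iso iso_imp_pow_bij assms(1,2) gM unfolding is_iso_def by blast
    next
      assume "G \<cong> ?K \<times>\<times> ?Z"
      then obtain f where f: "pow_bij f G (?K \<times>\<times> ?Z)"
        using iso_imp_pow_bij assms(1) gKZ unfolding is_iso_def by blast
      obtain h where h: "pow_bij h (?A \<times>\<times> ?Z) ?M"
        using AM iso_imp_pow_bij gAZ gM unfolding is_iso_def by blast
      have "pow_bij id ?Z ?Z" by (simp add: pow_bij_def)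
      then obtain g where g: "pow_bij g (?K \<times>\<times> ?Z) (?A \<times>\<times> ?Z)"
        using pow_bij_DirProd[OF pow_bij_heis[OF oddp]] by blast
      \<comment> \<open>The middle map \<open>g\<close> is no isomorphism: it replaces the
        Heisenberg factor by the elementary abelian one and preserves only powers.\<close>
      have "pow_bij (h \<circ> (g \<circ> f)) G ?M"
        by (rule pow_bij_trans[OF pow_bij_trans[OF f g] h])
      then show ?thesis
        using pow_bij_imp_epg_iso assms(1,2) gM by blast
    qed
  next
    assume "epg_iso G ?M"
    moreover have "epg_iso ?M (?A \<times>\<times> ?Z)"
    proof -
      have "?M \<cong> ?A \<times>\<times> ?Z" by (rule group.iso_sym[OF gAZ AM])
      moreover have "finite (carrier ?M)"
        using p0 assms(5) by (simp add: carrier_integer_mod_group)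
      ultimately show ?thesis
        using pow_bij_imp_epg_iso iso_imp_pow_bij gM gAZ unfolding is_iso_def by blast
    qed
    ultimately have epg: "epg_iso G (?A \<times>\<times> ?Z)" by (rule epg_iso_trans)
    have ordA: "order ?A = p ^ 3"
      using p0 card_elem_abelian_cube by (simp add: order_def)
    have pwA: "x [^]\<^bsub>?A\<^esub> p = \<one>\<^bsub>?A\<^esub>" for x
      by (cases x) (simp add: nat_pow_DirProd)
    interpret A: prime_cube_exponent_group ?A p n
      using gA assms(3,5,6) ordA pwA
      by (simp add: prime_cube_exponent_group_def prime_cube_exponent_group_axioms_def)
    obtain P where P: "subgroup P G" "card P = p ^ 3"
      "\<And>x. x \<in> P \<Longrightarrow> x [^]\<^bsub>G\<^esub> p = \<one>\<^bsub>G\<^esub>" "G\<lparr>carrier := P\<rparr> \<times>\<times> ?Z \<cong> G"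
      using A.epg_iso_imp_sylow_structure[OF assms(1,2) epg] by metis
    let ?P = "G\<lparr>carrier := P\<rparr>"
    interpret P: group ?P by (rule subgroup.subgroup_is_group[OF P(1) assms(1)])
    \<comment> \<open>The Sylow subgroup, taken as a group of its own, is one of the two classified
      groups and is then substituted in the product decomposition of \<open>G\<close>.\<close>
    have "?A \<cong> ?P \<or> ?K \<cong> ?P"
      using P by (intro P.order_prime_cube_cases assms(3)) (auto simp: order_def G.nat_pow_consistent[symmetric])
    then show "G \<cong> ?M \<or> G \<cong> ?K \<times>\<times> ?Z"
    proof
      assume "?A \<cong> ?P"
      then have "?A \<times>\<times> ?Z \<cong> G"
        using group.DirProd_iso_trans[OF gA _ iso_refl] P(4) iso_trans by blast
      then have "G \<cong> ?M"
        using group.iso_sym[OF gAZ] AM iso_trans by blast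
      then show ?thesis ..
    next
      assume "?K \<cong> ?P"
      then have "?K \<times>\<times> ?Z \<cong> G"
        using group.DirProd_iso_trans[OF gK _ iso_refl] P(4) iso_trans by blast
      then show ?thesis
        using group.iso_sym[OF gKZ] by blast
    qed
  qed
qed

end
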